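(* Let $m$ be a pre-measure, and let $R$ be its dual rule. Then, $X\in 2^{\omega}$ is $m$-random if and only if it is $R$-complex.
   Context: A pre-measure is a recursive function $m$ from finite sets of binary strings to $[0,\infty)$ with $m(\emptyset)=0$, $F_1\subseteq F_2\Rightarrow m(F_1)\le m(F_2)$, and $m(F_1\cup F_2)\le m(F_1)+m(F_2)$; it is extended to arbitrary $A\subseteq 2^{<\omega}$ by $m(A)=\sup\{m(F)\mid F\subseteq A \text{ finite}\}$. An $m$-test is a uniformly r.e. sequence $\{A_i\}$ with $m(A_i)\le 2^{-i}$; $X$ is $m$-random if $X\notin\bigcap_i[A_i]$ for every $m$-test, where $[A]$ is the open set of reals extending some member of $A$. A rule (for a complexity function) is a recursive set $R$ of finite subsets of $2^{<\omega}\times\mathbb{Z}$ such that $\emptyset\in R$; if $r\in R$ and $s\prec r$ then $s\in R$ (here $s\prec r$ means for every $(\sigma,d)\in s$ there is $d'\le d$ with $(\sigma,d')\in r$); and if $r,s\in R$ then $(r\cup s)^{+1}\in R$, where $r^{+i}=\{(\sigma,d+i)\mid(\sigma,d)\in r\}$. An $R$-optimal complexity function $K_R$ is a right r.e. function $K:2^{<\omega}\to\omega$ such that $\{(\sigma,K(\sigma))\mid\sigma\in F\}\in R$ for all finite $F$, and for every r.e. $A\subseteq 2^{<\omega}\times\omega$ all of whose finite subsets lie in $R$ there is $c$ with $K(\sigma)<d+c$ for all $(\sigma,d)\in A$. $X$ is $R$-complex if there is $c$ with $K_R(X\upharpoonright n)\ge n-c$ for all $n$. For a finite $r\subseteq 2^{<\omega}\times\mathbb{Z}$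 let $\mathring{r}=\{\sigma\mid\exists d\,(\sigma,d)\in r\}$ and $\|r\|=\min\{|\sigma|-d\mid(\sigma,d)\in r\}$ ($\|\emptyset\|=\infty$). For a pre-measure $m$ define the rule $m^{\mathrm{d}}=\{r\mid \forall s\subseteq r\ m(\mathring{s})\le 2^{-\|s\|}\}$, and for a rule $R$ define the pre-measure $R^{\mathrm{d}}(F)=\inf\{2^{-\|r_1\|}+\dots+2^{-\|r_l\|}\mid r_1,\dots,r_l\in R,\ F\subseteq\mathring{r_1}\cup\dots\cup\mathring{r_l}\}$. $R$ is a dual rule of $m$ if there is $c\in\omega$ with $K_R-c\le K_{m^{\mathrm{d}}}\le K_R+c$, equivalently there is $c$ with $(1/c)\,m\le R^{\mathrm{d}}\le c\,m$.
   Formalization: Added hypothesis: if some prefix of X has m-value 0, then infinitely many do. Without it the claim fails: for m(F)=|F∖{ε}| and R=m^d, no X is m-random (test A_i={ε}) yet every X is R-complex. *)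

theory Defs
  imports Complex_Main "HOL-Library.Nat_Bijection" "HOL-Library.Extended_Real"
begin

section \<open>Recursive functions, recursive sets and r.e. sets\<close>

text \<open>Kleene's total recursive functions: minimisation is applied to regular functions only.
  In \<open>recursive n f\<close> only the values of \<open>f\<close> on lists of length \<open>n\<close> are meaningful.\<close>

inductive recursive :: "nat \<Rightarrow> (nat list \<Rightarrow> nat) \<Rightarrow> bool" where
  zero: "recursive n (\<lambda>xs. 0)"
| succ: "recursive 1 (\<lambda>xs. Suc (hd xs))"
| proj: "i < n \<Longrightarrow> recursive n (\<lambda>xs. xs ! i)"
| comp: "recursive (length gs) f \<Longrightarrow> \<forall>g\<in>set gs. recursive n g \<Longrightarrow>
    recursive n (\<lambda>xs. f (map (\<lambda>g. g xs) gs))"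
| prim_rec: "recursive n f \<Longrightarrow> recursive (Suc (Suc n)) g \<Longrightarrow>
    recursive (Suc n) (\<lambda>xs. rec_nat (f (tl xs)) (\<lambda>k y. g (k # y # tl xs)) (hd xs))"
| minimisation: "recursive (Suc n) f \<Longrightarrow> \<forall>xs. length xs = n \<longrightarrow> (\<exists>k. f (k # xs) = 0) \<Longrightarrow>
    recursive n (\<lambda>xs. LEAST k. f (k # xs) = 0)"

definition recursive_set :: "nat set \<Rightarrow> bool" where
  "recursive_set A \<longleftrightarrow> (\<exists>f. recursive 1 f \<and> (\<forall>x. f [x] = (if x \<in> A then 1 else 0)))"

definition re_set :: "nat set \<Rightarrow> bool" where
  "re_set A \<longleftrightarrow> A = {} \<or> (\<exists>f. recursive 1 f \<and> A = range (\<lambda>k. f [k]))"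


section \<open>Codings\<close>

type_synonym bstring = "bool list"

text \<open>Bijective base-2 numeration.\<close>

fun bstring_encode :: "bstring \<Rightarrow> nat" where
  "bstring_encode [] = 0"
| "bstring_encode (b # \<sigma>) = 2 * bstring_encode \<sigma> + (if b then 2 else 1)"

lemma inj_bstring_encode: "inj bstring_encode"
proof (rule injI)
  fix x y show "bstring_encode x = bstring_encode y \<Longrightarrow> x = y"
  proof (induction x arbitrary: y)
    case Nil
    then show ?case by (cases y) (auto split: if_splits)
  next
    case (Cons a x)
    then obtain b y' where y: "y = b # y'"
      by (cases y) (auto split: if_splits)
    have "a = b \<and> bstring_encode x = bstring_encode y'"
      using Cons.prems unfolding y by (cases a; cases b; simp; presburger)
    then show ?case using Cons.IH y by blast
  qed
qed

lemma surj_bstring_encode: "surj bstring_encode"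
proof -
  have "\<exists>\<sigma>. bstring_encode \<sigma> = n" for n
  proof (induction n rule: less_induct)
    case (less n)
    show ?case
    proof (cases "n = 0")
      case True
      then show ?thesis by (metis bstring_encode.simps(1))
    next
      case False
      then have "(n - 1) div 2 < n" by auto
      then obtain \<sigma> where s: "bstring_encode \<sigma> = (n - 1) div 2" using less by blast
      have "bstring_encode (even n # \<sigma>) = n"
        using False s by (cases "even n") (auto elim!: evenE oddE)
      then show ?thesis by blast
    qed
  qed
  then show ?thesis by (metis surjI)
qed

definition finset_encode :: "bstring set \<Rightarrow> nat" where
  "finset_encode F = set_encode (bstring_encode ` F)"

definition finpairs_encode :: "(bstring \<times> int) set \<Rightarrow> nat" where
  "finpairs_encode r = set_encode ((\<lambda>(\<sigma>, d). prod_encode (bstring_encode \<sigma>, int_encode d)) ` r)"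

definition re_pairs :: "(bstring \<times> nat) set \<Rightarrow> bool" where
  "re_pairs A \<longleftrightarrow> re_set ((\<lambda>(\<sigma>, d). prod_encode (bstring_encode \<sigma>, d)) ` A)"

definition uniformly_re :: "(nat \<Rightarrow> bstring set) \<Rightarrow> bool" where
  "uniformly_re A \<longleftrightarrow> re_set {prod_encode (i, bstring_encode \<sigma>) | i \<sigma>. \<sigma> \<in> A i}"


section \<open>Pre-measures and randomness\<close>

text \<open>Only the values \<open>m F\<close> at finite \<open>F\<close> are meaningful.  A real-valued function is recursive if
  its values can be approximated uniformly to any given precision.\<close>

definition pre_measure :: "(bstring set \<Rightarrow> real) \<Rightarrow> bool" where
  "pre_measure m \<longleftrightarrow>
     (\<exists>f. recursive 2 f \<and>
        (\<forall>F k. finite F \<longrightarrow> \<bar>m F - real (f [finset_encode F, k]) / 2 ^ k\<bar> \<le> 1 / 2 ^ k)) \<and>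
     (\<forall>F. finite F \<longrightarrow> 0 \<le> m F) \<and>
     m {} = 0 \<and>
     (\<forall>F1 F2. finite F2 \<and> F1 \<subseteq> F2 \<longrightarrow> m F1 \<le> m F2) \<and>
     (\<forall>F1 F2. finite F1 \<and> finite F2 \<longrightarrow> m (F1 \<union> F2) \<le> m F1 + m F2)"

definition pm_extend :: "(bstring set \<Rightarrow> real) \<Rightarrow> bstring set \<Rightarrow> ereal" where
  "pm_extend m A = (SUP F\<in>{F. finite F \<and> F \<subseteq> A}. ereal (m F))"

definition initial_segment :: "(nat \<Rightarrow> bool) \<Rightarrow> nat \<Rightarrow> bstring"  (infix "\<restriction>" 105) where
  "X \<restriction> n = map X [0..<n]"

definition cylinder :: "bstring set \<Rightarrow> (nat \<Rightarrow> bool) set" where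
  "cylinder A = {X. \<exists>n. X \<restriction> n \<in> A}"

definition pm_test :: "(bstring set \<Rightarrow> real) \<Rightarrow> (nat \<Rightarrow> bstring set) \<Rightarrow> bool" where
  "pm_test m A \<longleftrightarrow> uniformly_re A \<and> (\<forall>i. pm_extend m (A i) \<le> ereal (1 / 2 ^ i))"

definition pm_random :: "(bstring set \<Rightarrow> real) \<Rightarrow> (nat \<Rightarrow> bool) \<Rightarrow> bool" where
  "pm_random m X \<longleftrightarrow> (\<forall>A. pm_test m A \<longrightarrow> X \<notin> (\<Inter>i. cylinder (A i)))"


section \<open>Rules and complexity\<close>

definition below :: "(bstring \<times> int) set \<Rightarrow> (bstring \<times> int) set \<Rightarrow> bool" where
  "below s r \<longleftrightarrow> (\<forall>(\<sigma>, d)\<in>s. \<exists>d'\<le>d. (\<sigma>, d') \<in> r)"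

definition shift :: "int \<Rightarrow> (bstring \<times> int) set \<Rightarrow> (bstring \<times> int) set" where
  "shift i r = (\<lambda>(\<sigma>, d). (\<sigma>, d + i)) ` r"

definition complexity_rule :: "(bstring \<times> int) set set \<Rightarrow> bool" where
  "complexity_rule R \<longleftrightarrow>
     (\<forall>r\<in>R. finite r) \<and>
     recursive_set (finpairs_encode ` R) \<and>
     {} \<in> R \<and>
     (\<forall>r s. r \<in> R \<and> finite s \<and> below s r \<longrightarrow> s \<in> R) \<and>
     (\<forall>r s. r \<in> R \<and> s \<in> R \<longrightarrow> shift 1 (r \<union> s) \<in> R)"

definition right_re :: "(bstring \<Rightarrow> nat) \<Rightarrow> bool" where
  "right_re K \<longleftrightarrow> re_pairs {(\<sigma>, d). K \<sigma> \<le> d}"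

definition optimal_complexity :: "(bstring \<times> int) set set \<Rightarrow> (bstring \<Rightarrow> nat) \<Rightarrow> bool" where
  "optimal_complexity R K \<longleftrightarrow>
     right_re K \<and>
     (\<forall>F. finite F \<longrightarrow> (\<lambda>\<sigma>. (\<sigma>, int (K \<sigma>))) ` F \<in> R) \<and>
     (\<forall>A. re_pairs A \<and> (\<forall>s. finite s \<and> s \<subseteq> A \<longrightarrow> (\<lambda>(\<sigma>, d). (\<sigma>, int d)) ` s \<in> R)
        \<longrightarrow> (\<exists>c. \<forall>(\<sigma>, d)\<in>A. K \<sigma> < d + c))"

text \<open>\<open>R\<close>-optimal complexity functions differ from each other by a bounded amount, so the choice
  of \<open>K\<close> is immaterial here and in \<open>dual_rule\<close>.\<close>

definition rule_complex :: "(bstring \<times> int) set set \<Rightarrow> (nat \<Rightarrow> bool) \<Rightarrow> bool" where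
  "rule_complex R X \<longleftrightarrow>
     (\<exists>K. optimal_complexity R K \<and> (\<exists>c::nat. \<forall>n. int (K (X \<restriction> n)) \<ge> int n - int c))"


section \<open>Duality\<close>

definition rule_norm :: "(bstring \<times> int) set \<Rightarrow> int" where
  "rule_norm r = Min ((\<lambda>(\<sigma>, d). int (length \<sigma>) - d) ` r)"

text \<open>\<open>2\<^sup>-\<^sup>\<parallel>\<^sup>r\<^sup>\<parallel>\<close>, where the norm of the empty set is infinite.\<close>

definition rule_weight :: "(bstring \<times> int) set \<Rightarrow> real" where
  "rule_weight r = (if r = {} then 0 else 2 powr (- real_of_int (rule_norm r)))"

text \<open>If \<open>m\<close> is recursive with real values, membership in \<open>pm_dual m\<close> need not be decidable;
  being \<open>pm_dual m\<close>-optimal makes sense nevertheless.\<close>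

definition pm_dual :: "(bstring set \<Rightarrow> real) \<Rightarrow> (bstring \<times> int) set set" where
  "pm_dual m = {r. finite r \<and> (\<forall>s\<subseteq>r. m (fst ` s) \<le> rule_weight s)}"

definition dual_rule :: "(bstring set \<Rightarrow> real) \<Rightarrow> (bstring \<times> int) set set \<Rightarrow> bool" where
  "dual_rule m R \<longleftrightarrow> complexity_rule R \<and>
     (\<exists>K K'. optimal_complexity R K \<and> optimal_complexity (pm_dual m) K' \<and>
        (\<exists>c::nat. \<forall>\<sigma>. int (K \<sigma>) - int c \<le> int (K' \<sigma>) \<and> int (K' \<sigma>) \<le> int (K \<sigma>) + int c))"

text \<open>A degenerate case has to be excluded when comparing randomness with complexity.
  For the pre-measure \<open>m F = card (F - {[]})\<close> the constant sequence \<open>{[]}\<close> is an \<open>m\<close>-test covering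
  every \<open>X\<close>, so no \<open>X\<close> is \<open>m\<close>-random, while every \<open>K\<close> with graph in \<open>pm_dual m\<close> satisfies
  \<open>K \<sigma> \<ge> length \<sigma>\<close> for \<open>\<sigma> \<noteq> []\<close>, so every \<open>X\<close> is complex.  The defect is that \<open>X\<close> has a null
  prefix, but only finitely many of them.  The condition below rules out exactly this; it holds
  for every \<open>X\<close> if all \<open>m {\<sigma>}\<close> are positive, and also if extensions of null strings are null.\<close>

definition null_prefixes_recur :: "(bstring set \<Rightarrow> real) \<Rightarrow> (nat \<Rightarrow> bool) \<Rightarrow> bool" where
  "null_prefixes_recur m X \<longleftrightarrow> (\<forall>n. m {X \<restriction> n} = 0 \<longrightarrow> (\<exists>k>n. m {X \<restriction> k} = 0))"

end

theory Submission
  imports Defs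
begin

text \<open>
  The sets \<open>{\<sigma>. K \<sigma> \<le> \<bar>\<sigma>\<bar> - i}\<close> form a test, so a random sequence is complex.  Conversely, let \<open>A\<close>
  be a test covering \<open>X\<close>.  The pairs \<open>(\<sigma>, \<bar>\<sigma>\<bar> + 1 - i)\<close> with \<open>\<sigma> \<in> A i\<close>, the subtraction being
  truncated at \<open>0\<close>, satisfy the dual rule, because a geometric series bounds \<open>m\<close> on \<open>\<Union>i\<ge>j. A i\<close>.
  If \<open>X\<close> is complex, optimality hence bounds \<open>min \<bar>\<sigma>\<bar> (i - 1)\<close> over all prefixes \<open>\<sigma> \<in> A i\<close> of \<open>X\<close>;
  thus one prefix of \<open>X\<close> lies in infinitely many \<open>A i\<close> and is null.  So \<open>X\<close> has infinitely many null
  prefixes.  But null strings have bounded complexity: \<open>(\<sigma>, 0)\<close> may be enumerated as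
  soon as \<open>m {\<sigma>}\<close> is known to be small relative to the code of \<open>\<sigma>\<close>.
\<close>

section \<open>Recursive functions\<close>

text \<open>\<open>recursive n\<close> fixes junk values on lists of the wrong length; here they are irrelevant.\<close>

definition computable :: "nat \<Rightarrow> (nat list \<Rightarrow> nat) \<Rightarrow> bool" where
  "computable n f \<longleftrightarrow> (\<exists>f'. recursive n f' \<and> (\<forall>xs. length xs = n \<longrightarrow> f' xs = f xs))"

lemma computable_recursive: "recursive n f \<Longrightarrow> computable n f"
  unfolding computable_def by blast

lemma computable_nth: "i < n \<Longrightarrow> computable n (\<lambda>xs. xs ! i)"
  by (intro computable_recursive recursive.proj)

lemma computable_comp1:
  assumes "computable 1 f" and "computable n g"
  shows "computable n (\<lambda>xs. f [g xs])"
proof -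
  obtain f' where f': "recursive 1 f'" "\<And>xs. length xs = 1 \<Longrightarrow> f' xs = f xs"
    using assms(1) unfolding computable_def by blast
  obtain g' where g': "recursive n g'" "\<And>xs. length xs = n \<Longrightarrow> g' xs = g xs"
    using assms(2) unfolding computable_def by blast
  have "recursive n (\<lambda>xs. f' (map (\<lambda>g. g xs) [g']))"
    using f'(1) g'(1) by (intro recursive.comp) auto
  then show ?thesis unfolding computable_def using f'(2) g'(2) by fastforce
qed

lemma computable_comp2:
  assumes "computable 2 f" and "computable n g" and "computable n h"
  shows "computable n (\<lambda>xs. f [g xs, h xs])"
proof -
  obtain f' where f': "recursive 2 f'" "\<And>xs. length xs = 2 \<Longrightarrow> f' xs = f xs"
    using assms(1) unfolding computable_def by blast
  obtain g' where g': "recursive n g'" "\<And>xs. length xs = n \<Longrightarrow> g' xs = g xs"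
    using assms(2) unfolding computable_def by blast
  obtain h' where h': "recursive n h'" "\<And>xs. length xs = n \<Longrightarrow> h' xs = h xs"
    using assms(3) unfolding computable_def by blast
  have "recursive n (\<lambda>xs. f' (map (\<lambda>g. g xs) [g', h']))"
    using f'(1) g'(1) h'(1) by (intro recursive.comp) (auto simp: numeral_2_eq_2)
  then show ?thesis unfolding computable_def using f'(2) g'(2) h'(2) by fastforce
qed

text \<open>\<open>h\<close> is given by its recursion equations instead of a \<open>rec_nat\<close>
  term, so that each application only has to check two equations. The recursion variable is the head
  of the argument list.\<close>

lemma computable_prim_rec:
  assumes "computable n f" and "computable (Suc (Suc n)) g"
    and h0: "\<And>xs. length xs = n \<Longrightarrow> h (0 # xs) = f xs"
    and hSuc: "\<And>k xs. length xs = n \<Longrightarrow> h (Suc k # xs) = g (k # h (k # xs) # xs)"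
  shows "computable (Suc n) h"
proof -
  obtain f' where f': "recursive n f'" "\<And>xs. length xs = n \<Longrightarrow> f' xs = f xs"
    using assms(1) unfolding computable_def by blast
  obtain g' where g': "recursive (Suc (Suc n)) g'" "\<And>xs. length xs = Suc (Suc n) \<Longrightarrow> g' xs = g xs"
    using assms(2) unfolding computable_def by blast
  let ?h' = "\<lambda>xs. rec_nat (f' (tl xs)) (\<lambda>k y. g' (k # y # tl xs)) (hd xs)"
  have "?h' (k # xs) = h (k # xs)" if "length xs = n" for k xs
    by (induction k) (simp_all add: that h0 hSuc f'(2) g'(2))
  then have "\<forall>xs. length xs = Suc n \<longrightarrow> ?h' xs = h xs"
    by (auto simp: length_Suc_conv)
  moreover have "recursive (Suc n) ?h'"
    using f'(1) g'(1) by (rule recursive.prim_rec)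
  ultimately show ?thesis unfolding computable_def by blast
qed

lemma computable_Least:
  assumes "computable (Suc n) f" and ex: "\<And>xs. length xs = n \<Longrightarrow> \<exists>k. f (k # xs) = 0"
  shows "computable n (\<lambda>xs. LEAST k. f (k # xs) = 0)"
proof -
  obtain f' where f': "recursive (Suc n) f'" "\<And>xs. length xs = Suc n \<Longrightarrow> f' xs = f xs"
    using assms(1) unfolding computable_def by blast
  have "recursive n (\<lambda>xs. LEAST k. f' (k # xs) = 0)"
    using f' ex by (intro recursive.minimisation) auto
  then show ?thesis unfolding computable_def using f'(2) by fastforce
qed

section \<open>Arithmetic with truncated subtraction\<close>

lemma computable_Suc: "computable n f \<Longrightarrow> computable n (\<lambda>xs. Suc (f xs))"
  using computable_comp1[OF computable_recursive[OF recursive.succ]] by simp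

lemma computable_const: "computable n (\<lambda>xs. c)"
  by (induction c) (simp_all add: computable_recursive recursive.zero computable_Suc)

lemma computable_add:
  assumes "computable n f" and "computable n g"
  shows "computable n (\<lambda>xs. f xs + g xs)"
proof -
  have "computable (Suc 1) (\<lambda>xs. xs ! 0 + xs ! 1)"
    by (rule computable_prim_rec[where f = "\<lambda>xs. xs ! 0" and g = "\<lambda>xs. Suc (xs ! 1)"])
      (auto intro!: computable_nth computable_Suc)
  then show ?thesis
    using computable_comp2[OF _ assms, of "\<lambda>xs. xs ! 0 + xs ! 1"] by (simp add: numeral_2_eq_2)
qed

lemma computable_diff:
  assumes "computable n f" and "computable n g"
  shows "computable n (\<lambda>xs. f xs - g xs)"
proof -
  \<comment> \<open>The step function returns the counter and ignores the previous value.\<close>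
  have pred: "computable (Suc 0) (\<lambda>xs. xs ! 0 - 1)"
    by (rule computable_prim_rec[where f = "\<lambda>xs. 0" and g = "\<lambda>xs. xs ! 0"])
      (auto intro!: computable_nth computable_const)
  have step: "computable (Suc (Suc (Suc 0))) (\<lambda>xs. xs ! 1 - 1)"
    using computable_comp1[of "\<lambda>xs. xs ! 0 - 1" _ "\<lambda>xs. xs ! 1"] pred
    by (simp add: computable_nth)
  \<comment> \<open>Recursion is on the head, so the subtrahend comes first;
    \<open>computable_comp2\<close> swaps the arguments back.\<close>
  have "computable (Suc (Suc 0)) (\<lambda>xs. xs ! 1 - xs ! 0)"
    by (rule computable_prim_rec[where f = "\<lambda>xs. xs ! 0" and g = "\<lambda>xs. xs ! 1 - 1"])
      (use step in \<open>simp_all add: computable_nth\<close>)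
  then show ?thesis
    using computable_comp2[OF _ assms(2,1), of "\<lambda>xs. xs ! 1 - xs ! 0"] by (simp add: numeral_2_eq_2)
qed

lemma computable_power2:
  assumes "computable n f"
  shows "computable n (\<lambda>xs. 2 ^ f xs)"
proof -
  have "computable (Suc 0) (\<lambda>xs. 2 ^ (xs ! 0))"
    by (rule computable_prim_rec[where f = "\<lambda>xs. 1" and g = "\<lambda>xs. xs ! 1 + xs ! 1"])
      (auto intro!: computable_nth computable_const computable_add)
  then show ?thesis using computable_comp1[OF _ assms, of "\<lambda>xs. 2 ^ (xs ! 0)"] by simp
qed

section \<open>Cantor pairing and its inverse\<close>

lemma computable_triangle:
  assumes "computable n f"
  shows "computable n (\<lambda>xs. triangle (f xs))"
proof -
  have "computable (Suc 0) (\<lambda>xs. triangle (xs ! 0))"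
    by (rule computable_prim_rec[where f = "\<lambda>xs. 0" and g = "\<lambda>xs. xs ! 1 + Suc (xs ! 0)"])
      (auto intro!: computable_nth computable_const computable_add computable_Suc)
  then show ?thesis using computable_comp1[OF _ assms, of "\<lambda>xs. triangle (xs ! 0)"] by simp
qed

lemma computable_prod_encode:
  assumes "computable n f" and "computable n g"
  shows "computable n (\<lambda>xs. prod_encode (f xs, g xs))"
  using computable_add[OF computable_triangle[OF computable_add[OF assms]] assms(1)]
  by (simp add: prod_encode_def)

lemma triangle_mono: "a \<le> b \<Longrightarrow> triangle a \<le> triangle b"
  unfolding triangle_def by (intro div_le_mono mult_le_mono) auto

lemma prod_decode_conv_triangle:
  "x = triangle (fst (prod_decode x) + snd (prod_decode x)) + fst (prod_decode x)"
  using prod_decode_inverse[of x] unfolding prod_encode_def by (simp add: case_prod_beta)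

text \<open>The sum numbers the diagonal of Cantor's enumeration that contains \<open>x\<close>: it
  is the least \<open>k\<close> with \<open>x < triangle (Suc k)\<close>. Truncated subtraction
  turns this inequality into a zero of \<open>?f\<close>, as minimisation requires.\<close>

lemma computable_prod_decode_sum:
  "computable 1 (\<lambda>xs. fst (prod_decode (xs ! 0)) + snd (prod_decode (xs ! 0)))"
proof -
  let ?f = "\<lambda>xs. Suc (xs ! 1) - triangle (Suc (xs ! 0))"
  have least: "(LEAST k. ?f [k, x] = 0) = fst (prod_decode x) + snd (prod_decode x)" for x
  proof -
    obtain a b where ab: "prod_decode x = (a, b)" by fastforce
    then have x: "x = triangle (a + b) + a" using prod_decode_conv_triangle[of x] by simp
    have "(LEAST k. x < triangle (Suc k)) = a + b"
    proof (rule Least_equality)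
      show "x < triangle (Suc (a + b))" by (simp add: x)
      show "a + b \<le> k" if "x < triangle (Suc k)" for k
      proof (rule ccontr)
        assume "\<not> a + b \<le> k"
        then have "triangle (Suc k) \<le> triangle (a + b)" by (intro triangle_mono) simp
        then show False using that x by simp
      qed
    qed
    then show ?thesis by (simp add: ab less_Suc_eq_le)
  qed
  have "computable 1 (\<lambda>xs. LEAST k. ?f (k # xs) = 0)"
  proof (rule computable_Least)
    show "computable (Suc 1) ?f"
      by (intro computable_diff computable_Suc computable_triangle computable_nth) auto
    show "\<exists>k. ?f (k # xs) = 0" if "length xs = 1" for xs
      by (rule exI[of _ "xs ! 0"]) (simp add: triangle_Suc)
  qed
  then show ?thesis using least by simp
qed

lemma computable_prod_decode:
  assumes "computable n f"
  shows "computable n (\<lambda>xs. fst (prod_decode (f xs)))" (is ?fst)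
    and "computable n (\<lambda>xs. snd (prod_decode (f xs)))" (is ?snd)
proof -
  let ?s = "\<lambda>x. fst (prod_decode x) + snd (prod_decode x)"
  have s: "computable n (\<lambda>xs. ?s (f xs))"
    using computable_comp1[OF computable_prod_decode_sum assms] by simp
  have "fst (prod_decode x) = x - triangle (?s x)" for x
    using prod_decode_conv_triangle[of x] by linarith
  then show ?fst
    using computable_diff[OF assms computable_triangle[OF s]] by presburger
  from computable_diff[OF s this] show ?snd by simp
qed

section \<open>Lengths of coded strings\<close>

text \<open>In bijective base 2 the strings of length \<open>n\<close> fill the block of codes from
  \<open>2 ^ n - 1\<close> to \<open>2 ^ (n + 1) - 2\<close>, so minimisation can recover the length
  from the code.\<close>

lemma bstring_encode_bounds:
  "2 ^ length \<sigma> \<le> Suc (bstring_encode \<sigma>)" "Suc (bstring_encode \<sigma>) < 2 ^ Suc (length \<sigma>)"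
  by (induction \<sigma>) (auto split: if_splits)

lemma length_le_bstring_encode: "length \<sigma> \<le> bstring_encode \<sigma>"
  by (induction \<sigma>) (auto split: if_splits)

definition code_length :: "nat \<Rightarrow> nat" where
  "code_length x = length (inv bstring_encode x)"

lemma code_length_encode [simp]: "code_length (bstring_encode \<sigma>) = length \<sigma>"
  by (simp add: code_length_def inj_bstring_encode)

lemma code_length_Least: "code_length x = (LEAST k. Suc (Suc x) - 2 ^ Suc k = 0)"
proof -
  obtain \<sigma> where x: "x = bstring_encode \<sigma>" using surj_bstring_encode by blast
  have "(LEAST k. Suc (Suc x) - 2 ^ Suc k = 0) = length \<sigma>"
  proof (rule Least_equality)
    show "Suc (Suc x) - 2 ^ Suc (length \<sigma>) = 0"
      using bstring_encode_bounds(2)[of \<sigma>] x by simp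
    fix k assume "Suc (Suc x) - 2 ^ Suc k = 0"
    then have "(2::nat) ^ length \<sigma> < 2 ^ Suc k"
      using bstring_encode_bounds(1)[of \<sigma>] x by simp
    then show "length \<sigma> \<le> k" by (meson less_Suc_eq_le one_less_numeral_iff
      power_less_imp_less_exp semiring_norm(76))
  qed
  then show ?thesis by (simp add: x)
qed

lemma computable_code_length:
  assumes "computable n f"
  shows "computable n (\<lambda>xs. code_length (f xs))"
proof -
  let ?f = "\<lambda>xs. Suc (Suc (xs ! 1)) - 2 ^ Suc (xs ! 0)"
  have "computable 1 (\<lambda>xs. LEAST k. ?f (k # xs) = 0)"
  proof (rule computable_Least)
    show "computable (Suc 1) ?f"
      by (intro computable_diff computable_Suc computable_power2 computable_nth) auto
    show "\<exists>k. ?f (k # xs) = 0" if "length xs = 1" for xs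
      using less_exp[of "Suc (xs ! 0)"] by (intro exI[of _ "xs ! 0"]) simp
  qed
  from computable_comp1[OF this assms] show ?thesis by (simp add: code_length_Least)
qed


section \<open>Recursively enumerable sets\<close>

lemma re_set_UNIV: "re_set UNIV"
proof -
  have "recursive 1 (\<lambda>xs. xs ! 0)" by (rule recursive.proj) simp
  then show ?thesis unfolding re_set_def by (intro disjI2 exI[of _ "\<lambda>xs. xs ! 0"]) auto
qed

text \<open>The common source of all enumerability proofs below: run through \<open>S\<close>, keep
  the elements passing the decidable test \<open>p v = 0\<close>, and apply
  \<open>g\<close>.\<close>

lemma re_set_filter_image:
  assumes "re_set S"
    and g: "computable 1 (\<lambda>xs. g (xs ! 0))" and p: "computable 1 (\<lambda>xs. p (xs ! 0))"
  shows "re_set (g ` {v \<in> S. p v = 0})"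
proof (cases "{v \<in> S. p v = 0} = {}")
  case True
  then show ?thesis unfolding re_set_def by simp
next
  case False
  then obtain f where f: "recursive 1 f" and S: "S = range (\<lambda>k. f [k])"
    using \<open>re_set S\<close> unfolding re_set_def by blast
  have "\<exists>j. p (f [j]) = 0" using False S by auto
  \<comment> \<open>The index \<open>j\<close> is the fallback: whenever an element fails the test,
    element \<open>j\<close> is listed again, which keeps the enumeration total.\<close>
  then obtain j where j: "p (f [j]) = 0" ..
  \<comment> \<open>Case distinction as a primitive recursion whose step is constant.\<close>
  have "computable (Suc (Suc 0)) (\<lambda>xs. if xs ! 0 = 0 then xs ! 1 else j)"
    by (rule computable_prim_rec[where f = "\<lambda>xs. xs ! 0" and g = "\<lambda>xs. j"])
      (auto intro!: computable_const computable_nth)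
  moreover have "computable 1 (\<lambda>xs. p (f [xs ! 0]))"
    using computable_comp1[OF p computable_comp1[OF computable_recursive[OF f] computable_nth]] by simp
  ultimately have "computable 1 (\<lambda>xs. if p (f [xs ! 0]) = 0 then xs ! 0 else j)"
    using computable_comp2[of "\<lambda>xs. if xs ! 0 = 0 then xs ! 1 else j" 1 "\<lambda>xs. p (f [xs ! 0])" "\<lambda>xs. xs ! 0"]
    by (simp add: numeral_2_eq_2 computable_nth cong: if_cong)
  from computable_comp1[OF g computable_comp1[OF computable_recursive[OF f] this]]
  obtain h where h: "recursive 1 h"
    "\<And>xs. length xs = 1 \<Longrightarrow> h xs = g (f [if p (f [xs ! 0]) = 0 then xs ! 0 else j])"
    unfolding computable_def by auto
  have "g ` {v \<in> S. p v = 0} = range (\<lambda>k. h [k])"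
    using j by (force simp: S h(2) image_iff)
  then show ?thesis unfolding re_set_def using h(1) by blast
qed


section \<open>Randomness and complexity\<close>

lemma right_re_deficiency_uniformly_re:
  assumes "right_re K"
  shows "uniformly_re (\<lambda>i. {\<sigma>. K \<sigma> + i \<le> length \<sigma>})"
proof -
  let ?S = "(\<lambda>(\<sigma>, d). prod_encode (bstring_encode \<sigma>, d)) ` {(\<sigma>, d). K \<sigma> \<le> d}"
  let ?c = "\<lambda>v. fst (prod_decode v)" and ?d = "\<lambda>v. snd (prod_decode v)"
  let ?g = "\<lambda>v. prod_encode (code_length (?c v) - ?d v, ?c v)"
  \<comment> \<open>The test keeps the pairs with \<open>d\<close> at most the length. Otherwise
    truncated subtraction in \<open>?g\<close> could put a string of complexity above its length
    into level \<open>0\<close>.\<close>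
  let ?p = "\<lambda>v. ?d v - code_length (?c v)"
  have "re_set (?g ` {v \<in> ?S. ?p v = 0})"
    using assms unfolding right_re_def re_pairs_def
    by (intro re_set_filter_image computable_prod_encode computable_diff computable_code_length
        computable_prod_decode computable_nth) auto
  also have "?g ` {v \<in> ?S. ?p v = 0} =
      {prod_encode (i, bstring_encode \<sigma>) |i \<sigma>. \<sigma> \<in> {\<sigma>. K \<sigma> + i \<le> length \<sigma>}}" (is "_ = ?T")
  proof
    show "?g ` {v \<in> ?S. ?p v = 0} \<subseteq> ?T" by fastforce
    show "?T \<subseteq> ?g ` {v \<in> ?S. ?p v = 0}"
    proof
      fix x assume "x \<in> ?T"
      then obtain i \<sigma> where x: "x = prod_encode (i, bstring_encode \<sigma>)" "K \<sigma> + i \<le> length \<sigma>" by blast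
      let ?v = "prod_encode (bstring_encode \<sigma>, length \<sigma> - i)"
      have "?v \<in> {v \<in> ?S. ?p v = 0}" using x(2) by force
      moreover have "x = ?g ?v" using x by simp
      ultimately show "x \<in> ?g ` {v \<in> ?S. ?p v = 0}" by blast
    qed
  qed
  finally show ?thesis unfolding uniformly_re_def .
qed

text \<open>The upper graph of \<open>K'\<close> competes against \<open>K\<close>: its finite
  subsets lie below finite parts of the graph of \<open>K'\<close>, so downward closure puts them
  into \<open>R\<close>.\<close>

lemma optimal_complexity_dominates:
  assumes "\<forall>r s. r \<in> R \<and> finite s \<and> below s r \<longrightarrow> s \<in> R"
    and "optimal_complexity R K" and "optimal_complexity R K'"
  obtains c where "\<And>\<sigma>. K \<sigma> < K' \<sigma> + c"
proof -
  let ?A = "{(\<sigma>, d). K' \<sigma> \<le> d}"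
  have "(\<lambda>(\<sigma>, d). (\<sigma>, int d)) ` s \<in> R" if "finite s" "s \<subseteq> ?A" for s
  proof (rule assms(1)[rule_format], intro conjI)
    show "(\<lambda>\<sigma>. (\<sigma>, int (K' \<sigma>))) ` fst ` s \<in> R"
      using assms(3) \<open>finite s\<close> unfolding optimal_complexity_def by blast
    show "below ((\<lambda>(\<sigma>, d). (\<sigma>, int d)) ` s) ((\<lambda>\<sigma>. (\<sigma>, int (K' \<sigma>))) ` fst ` s)"
      using \<open>s \<subseteq> ?A\<close> unfolding below_def by (force simp: image_iff)
  qed (use that in simp)
  moreover have "re_pairs ?A"
    using assms(3) unfolding optimal_complexity_def right_re_def by blast
  ultimately obtain c where "\<forall>(\<sigma>, d)\<in>?A. K \<sigma> < d + c"
    using assms(2) unfolding optimal_complexity_def by blast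
  then show thesis by (intro that[of c]) auto
qed

text \<open>Replaces \<open>R\<close> by the dual rule with one \<open>K\<close> serving all
  \<open>X\<close>. The function witnessing \<open>rule_complex\<close> may differ from the one in
  \<open>dual_rule\<close>, whence the extra constant from domination.\<close>

lemma rule_complex_iff_dual:
  assumes "dual_rule m R"
  obtains K where "optimal_complexity (pm_dual m) K"
    and "\<And>X. rule_complex R X \<longleftrightarrow> (\<exists>c::nat. \<forall>n. n \<le> K (X \<restriction> n) + c)"
proof -
  obtain K K' c where R: "complexity_rule R" and K: "optimal_complexity R K"
    and K': "optimal_complexity (pm_dual m) K'"
    and c: "\<And>\<sigma>. int (K \<sigma>) - int c \<le> int (K' \<sigma>) \<and> int (K' \<sigma>) \<le> int (K \<sigma>) + int c"
    using assms unfolding dual_rule_def by blast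
  have down: "\<forall>r s. r \<in> R \<and> finite s \<and> below s r \<longrightarrow> s \<in> R"
    using R unfolding complexity_rule_def by blast
  have "rule_complex R X \<longleftrightarrow> (\<exists>c::nat. \<forall>n. n \<le> K' (X \<restriction> n) + c)" for X
  proof
    assume "rule_complex R X"
    then obtain K2 c2 where K2: "optimal_complexity R K2"
      and c2: "\<And>n. int (K2 (X \<restriction> n)) \<ge> int n - int c2" unfolding rule_complex_def by blast
    obtain b where b: "\<And>\<sigma>. K2 \<sigma> < K \<sigma> + b" using optimal_complexity_dominates[OF down K2 K] by blast
    have "n \<le> K' (X \<restriction> n) + (c + c2 + b)" for n
      using c[of "X \<restriction> n"] c2[of n] b[of "X \<restriction> n"] by linarith
    then show "\<exists>c. \<forall>n. n \<le> K' (X \<restriction> n) + c" by blast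
  next
    assume "\<exists>c. \<forall>n. n \<le> K' (X \<restriction> n) + c"
    then obtain b where b: "\<And>n. n \<le> K' (X \<restriction> n) + b" by blast
    have "int (K (X \<restriction> n)) \<ge> int n - int (b + c)" for n
      using c[of "X \<restriction> n"] b[of n] by linarith
    then show "rule_complex R X" unfolding rule_complex_def using K by blast
  qed
  then show thesis using K' that by blast
qed

section \<open>Estimates for pre-measures and membership in the dual rule\<close>

lemma pre_measureD:
  assumes "pre_measure m"
  shows "finite F \<Longrightarrow> 0 \<le> m F" and "m {} = 0"
    and "finite G \<Longrightarrow> F \<subseteq> G \<Longrightarrow> m F \<le> m G"
    and "finite F \<Longrightarrow> finite G \<Longrightarrow> m (F \<union> G) \<le> m F + m G"
  using assms unfolding pre_measure_def by blast+

lemma pre_measure_UN_le: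
  assumes "pre_measure m" and "finite I" and "\<And>i. i \<in> I \<Longrightarrow> finite (D i)"
  shows "m (\<Union>i\<in>I. D i) \<le> (\<Sum>i\<in>I. m (D i))"
  using \<open>finite I\<close> assms(3)
proof (induction I rule: finite_induct)
  case empty
  then show ?case using pre_measureD(2)[OF assms(1)] by simp
next
  case (insert i I)
  then have "m (D i \<union> (\<Union>i\<in>I. D i)) \<le> m (D i) + m (\<Union>i\<in>I. D i)"
    by (intro pre_measureD(4)[OF assms(1)]) auto
  then show ?case using insert by simp
qed

lemma pm_extend_le_iff:
  "pm_extend m A \<le> ereal x \<longleftrightarrow> (\<forall>F. finite F \<and> F \<subseteq> A \<longrightarrow> m F \<le> x)"
  unfolding pm_extend_def by (auto simp: SUP_le_iff)

lemma sum_half_powers_le: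
  assumes "finite I" and "\<And>i. i \<in> I \<Longrightarrow> a \<le> i"
  shows "(\<Sum>i\<in>I. 1 / 2 ^ i :: real) \<le> 2 / 2 ^ a"
proof -
  have tail: "(\<Sum>i=a..<a + n. 1 / 2 ^ i :: real) = 2 / 2 ^ a - 2 / 2 ^ (a + n)" for n
  proof (induction n)
    case (Suc n)
    have "(2::real) / 2 ^ (a + n) = 1 / 2 ^ (a + n) + 2 / 2 ^ (a + Suc n)" by (simp add: field_simps)
    then show ?case using Suc by simp
  qed simp
  obtain b where b: "\<And>i. i \<in> I \<Longrightarrow> i < b" using \<open>finite I\<close> unfolding finite_nat_set_iff_bounded by blast
  have "(\<Sum>i\<in>I. 1 / 2 ^ i :: real) \<le> (\<Sum>i=a..<a + b. 1 / 2 ^ i)"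
  proof (rule sum_mono2)
    show "I \<subseteq> {a..<a + b}"
    proof
      fix i assume "i \<in> I"
      from b[OF this] assms(2)[OF this] show "i \<in> {a..<a + b}" by simp
    qed
  qed auto
  also have "\<dots> = 2 / 2 ^ a - 2 / 2 ^ (a + b)" by (rule tail)
  also have "\<dots> \<le> 2 / 2 ^ a" by simp
  finally show ?thesis .
qed

text \<open>A subset \<open>s\<close> is covered by levels \<open>D i\<close> with \<open>i\<close>
  above its norm, so a geometric series starting at the norm plus one bounds its measure. The strict
  inequality in \<open>cover\<close> absorbs the factor 2 of that series.\<close>

lemma pm_dualI_summable_cover:
  assumes m: "pre_measure m" and "finite r"
    and cover: "\<And>\<sigma> d. (\<sigma>, d) \<in> r \<Longrightarrow> \<exists>i. int (length \<sigma>) - d < int i \<and> \<sigma> \<in> D i"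
    and small: "\<And>i F. finite F \<Longrightarrow> F \<subseteq> D i \<Longrightarrow> m F \<le> 1 / 2 ^ i"
  shows "r \<in> pm_dual m"
  unfolding pm_dual_def
proof (intro CollectI conjI allI impI)
  fix s assume "s \<subseteq> r"
  have fin: "finite s" using \<open>s \<subseteq> r\<close> \<open>finite r\<close> by (rule finite_subset)
  show "m (fst ` s) \<le> rule_weight s"
  proof (cases "s = {}")
    case True
    then show ?thesis by (simp add: rule_weight_def pre_measureD(2)[OF m])
  next
    case False
    have "\<forall>x\<in>s. \<exists>i. int (length (fst x)) - snd x < int i \<and> fst x \<in> D i"
      using cover \<open>s \<subseteq> r\<close> by fastforce
    then obtain \<iota> where \<iota>: "\<And>x. x \<in> s \<Longrightarrow> int (length (fst x)) - snd x < int (\<iota> x)"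
      "\<And>x. x \<in> s \<Longrightarrow> fst x \<in> D (\<iota> x)" by metis
    \<comment> \<open>If the norm is negative, \<open>?a\<close> is \<open>0\<close>; the series
      bound 2 is then still at most the weight.\<close>
    let ?a = "nat (rule_norm s + 1)"
    have a: "?a \<le> \<iota> x" if "x \<in> s" for x
    proof -
      have "rule_norm s \<le> int (length (fst x)) - snd x"
        unfolding rule_norm_def using fin that by (intro Min_le) (auto simp: case_prod_beta')
      then show ?thesis using \<iota>(1)[OF that] by linarith
    qed
    \<comment> \<open>The union runs over the set of levels, not over the elements of
      \<open>s\<close>: each level is charged once, however many strings it holds.\<close>
    have "m (fst ` s) \<le> m (\<Union>i\<in>\<iota> ` s. fst ` s \<inter> D i)"
      using fin \<iota>(2) by (intro pre_measureD(3)[OF m]) auto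
    also have "\<dots> \<le> (\<Sum>i\<in>\<iota> ` s. m (fst ` s \<inter> D i))"
      using fin by (intro pre_measure_UN_le[OF m]) auto
    also have "\<dots> \<le> (\<Sum>i\<in>\<iota> ` s. 1 / 2 ^ i)"
      using fin by (intro sum_mono small) auto
    also have "\<dots> \<le> 2 / 2 ^ ?a"
      using fin a by (intro sum_half_powers_le) auto
    also have "\<dots> = 2 powr (1 - real ?a)"
      by (simp add: powr_diff powr_realpow)
    also have "\<dots> \<le> 2 powr (- real_of_int (rule_norm s))"
      by (intro powr_mono) linarith+
    finally show ?thesis using False by (simp add: rule_weight_def)
  qed
qed fact

lemma pm_dual_weight:
  assumes "r \<in> pm_dual m" and "r \<noteq> {}" and "\<And>\<sigma> d. (\<sigma>, d) \<in> r \<Longrightarrow> int i \<le> int (length \<sigma>) - d"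
  shows "m (fst ` r) \<le> 1 / 2 ^ i"
proof -
  have "finite r" and "m (fst ` r) \<le> rule_weight r"
    using assms(1) unfolding pm_dual_def by auto
  moreover have "int i \<le> rule_norm r"
    unfolding rule_norm_def using \<open>finite r\<close> assms(2,3) by (subst Min_ge_iff) auto
  then have "rule_weight r \<le> 2 powr (- real i)"
    using assms(2) unfolding rule_weight_def by (auto intro!: powr_mono)
  moreover have "2 powr (- real i) = 1 / 2 ^ i"
    by (simp add: powr_minus powr_realpow inverse_eq_divide)
  ultimately show ?thesis by linarith
qed

section \<open>Random sequences are complex\<close>

lemma pm_random_imp_complex:
  assumes m: "pre_measure m" and K: "optimal_complexity (pm_dual m) K" and X: "pm_random m X"
  shows "\<exists>c::nat. \<forall>n. n \<le> K (X \<restriction> n) + c"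
proof (rule ccontr)
  assume "\<not> ?thesis"
  \<comment> \<open>Failure of every constant \<open>i\<close> places some prefix in every level of
    the deficiency test.\<close>
  then have deep: "\<exists>n. K (X \<restriction> n) + i < n" for i by (meson not_le)
  let ?A = "\<lambda>i. {\<sigma>. K \<sigma> + i \<le> length \<sigma>}"
  have "m F \<le> 1 / 2 ^ i" if F: "finite F" "F \<subseteq> ?A i" for F i
  proof (cases "F = {}")
    case True
    then show ?thesis by (simp add: pre_measureD(2)[OF m])
  next
    case False
    let ?r = "(\<lambda>\<sigma>. (\<sigma>, int (K \<sigma>))) ` F"
    have "?r \<in> pm_dual m" using K F(1) unfolding optimal_complexity_def by blast
    then have "m (fst ` ?r) \<le> 1 / 2 ^ i" by (rule pm_dual_weight) (use F False in auto)
    then show ?thesis by (simp add: image_image)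
  qed
  moreover have "uniformly_re ?A"
    using K unfolding optimal_complexity_def by (intro right_re_deficiency_uniformly_re) blast
  ultimately have "pm_test m ?A" unfolding pm_test_def by (simp add: pm_extend_le_iff)
  moreover have "X \<in> (\<Inter>i. cylinder (?A i))"
    unfolding cylinder_def
  proof (intro INT_I CollectI)
    fix i
    obtain n where "K (X \<restriction> n) + i < n" using deep by blast
    then show "\<exists>n. X \<restriction> n \<in> ?A i"
      by (auto simp: initial_segment_def intro: less_imp_le)
  qed
  ultimately show False using X unfolding pm_random_def by blast
qed

section \<open>Complex sequences are random\<close>

lemma test_complexity_bound:
  assumes m: "pre_measure m" and K: "optimal_complexity (pm_dual m) K" and A: "pm_test m A"
  obtains c where "\<And>i \<sigma>. \<sigma> \<in> A i \<Longrightarrow> K \<sigma> < (length \<sigma> + 1 - i) + c"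
proof -
  let ?B = "{(\<sigma>, length \<sigma> + 1 - i) |\<sigma> i. \<sigma> \<in> A i}"
  have "(\<lambda>(\<sigma>, d). (\<sigma>, int d)) ` s \<in> pm_dual m" if s: "finite s" "s \<subseteq> ?B" for s
  proof (rule pm_dualI_summable_cover[OF m, of _ A])
    show "finite ((\<lambda>(\<sigma>, d). (\<sigma>, int d)) ` s)" using s by simp
    show "m F \<le> 1 / 2 ^ i" if "finite F" "F \<subseteq> A i" for i F
      using A that unfolding pm_test_def pm_extend_le_iff by blast
    show "\<exists>i. int (length \<sigma>) - d < int i \<and> \<sigma> \<in> A i"
      if \<sigma>d: "(\<sigma>, d) \<in> (\<lambda>(\<sigma>, d). (\<sigma>, int d)) ` s" for \<sigma> d
    proof -
      obtain d' where "(\<sigma>, d') \<in> s" "d = int d'" using \<sigma>d by auto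
      then obtain i where "\<sigma> \<in> A i" "d = int (length \<sigma> + 1 - i)" using s(2) by blast
      \<comment> \<open>The \<open>+ 1\<close> in the second component makes the inequality strict;
        truncation at \<open>0\<close> only raises that component and so preserves it.\<close>
      then show ?thesis by (intro exI[of _ i]) linarith
    qed
  qed
  moreover have "re_pairs ?B"
  proof -
    let ?S = "{prod_encode (i, bstring_encode \<sigma>) | i \<sigma>. \<sigma> \<in> A i}"
    let ?i = "\<lambda>v. fst (prod_decode v)" and ?c = "\<lambda>v. snd (prod_decode v)"
    let ?g = "\<lambda>v. prod_encode (?c v, code_length (?c v) + 1 - ?i v)"
    \<comment> \<open>The trivial test fits the shape of \<open>re_set_filter_image\<close>.\<close>
    have "re_set (?g ` {v \<in> ?S. 0 = (0::nat)})"
      using A unfolding pm_test_def uniformly_re_def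
      by (intro re_set_filter_image computable_prod_encode computable_diff computable_code_length
          computable_prod_decode computable_nth computable_const computable_add) auto
    also have "?g ` {v \<in> ?S. 0 = (0::nat)} = (\<lambda>(\<sigma>, d). prod_encode (bstring_encode \<sigma>, d)) ` ?B"
    proof
      show "?g ` {v \<in> ?S. 0 = (0::nat)} \<subseteq> (\<lambda>(\<sigma>, d). prod_encode (bstring_encode \<sigma>, d)) ` ?B"
        by force
      show "(\<lambda>(\<sigma>, d). prod_encode (bstring_encode \<sigma>, d)) ` ?B \<subseteq> ?g ` {v \<in> ?S. 0 = (0::nat)}"
      proof
        fix x assume "x \<in> (\<lambda>(\<sigma>, d). prod_encode (bstring_encode \<sigma>, d)) ` ?B"
        then obtain i \<sigma> where "\<sigma> \<in> A i" "x = prod_encode (bstring_encode \<sigma>, length \<sigma> + 1 - i)"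
          by auto
        then show "x \<in> ?g ` {v \<in> ?S. 0 = (0::nat)}"
          by (intro image_eqI[of _ _ "prod_encode (i, bstring_encode \<sigma>)"]) auto
      qed
    qed
    finally show ?thesis unfolding re_pairs_def .
  qed
  ultimately obtain c where "\<forall>(\<sigma>, d)\<in>?B. K \<sigma> < d + c"
    using K unfolding optimal_complexity_def by blast
  then show thesis by (intro that[of c]) blast
qed

text \<open>Approximations need not decide whether \<open>m {\<sigma>}\<close> vanishes, so a
  decidable larger set is enumerated: the strings whose measure is certified small relative to their
  code. Distinct codes give distinct levels, so these bounds sum up.\<close>

lemma null_complexity_bound:
  assumes m: "pre_measure m" and K: "optimal_complexity (pm_dual m) K"
  obtains c where "\<And>\<sigma>. m {\<sigma>} = 0 \<Longrightarrow> K \<sigma> < c"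
proof -
  have "\<exists>f. recursive 2 f \<and>
      (\<forall>F k. finite F \<longrightarrow> \<bar>m F - real (f [finset_encode F, k]) / 2 ^ k\<bar> \<le> 1 / 2 ^ k)"
    using m[unfolded pre_measure_def] by (rule conjunct1)
  then obtain f where f: "recursive 2 f"
    and approx: "\<And>F k. finite F \<Longrightarrow> \<bar>m F - real (f [finset_encode F, k]) / 2 ^ k\<bar> \<le> 1 / 2 ^ k"
    by metis
  \<comment> \<open>\<open>2 ^ e\<close> is the code of the singleton of the string coded by
    \<open>e\<close>. The test is that the approximation is at most 1: null strings pass it, and
    passing bounds the measure by two units of size \<open>1 / 2 ^ (e + 2)\<close>.\<close>
  define p where "p e = f [2 ^ e, e + 2] - 1" for e
  have fp: "f [finset_encode {\<sigma>}, bstring_encode \<sigma> + 2] \<le> 1 \<longleftrightarrow> p (bstring_encode \<sigma>) = 0" for \<sigma>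
    by (simp add: p_def finset_encode_def set_encode_def)
  have p_null: "p (bstring_encode \<sigma>) = 0" if "m {\<sigma>} = 0" for \<sigma>
    using approx[of "{\<sigma>}" "bstring_encode \<sigma> + 2"] that fp[of \<sigma>] by (simp add: divide_le_cancel)
  have p_small: "m {\<sigma>} \<le> 1 / 2 ^ Suc (bstring_encode \<sigma>)" if "p (bstring_encode \<sigma>) = 0" for \<sigma>
  proof -
    let ?e = "bstring_encode \<sigma>"
    have "m {\<sigma>} \<le> real (f [finset_encode {\<sigma>}, ?e + 2]) / 2 ^ (?e + 2) + 1 / 2 ^ (?e + 2)"
      using approx[of "{\<sigma>}" "?e + 2"] by (simp add: abs_le_iff)
    also have "\<dots> \<le> 1 / 2 ^ (?e + 2) + 1 / 2 ^ (?e + 2)"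
      using fp[of \<sigma>] that by (intro add_right_mono divide_right_mono) auto
    also have "\<dots> = 1 / 2 ^ Suc ?e" by (simp add: field_simps)
    finally show ?thesis .
  qed
  let ?C = "{(\<sigma>, 0::nat) |\<sigma>. p (bstring_encode \<sigma>) = 0}"
  \<comment> \<open>Each level holds at most one string. Its index exceeds the length of that string
    because a code is at least the length, as the pair with second component \<open>0\<close>
    requires.\<close>
  let ?D = "\<lambda>i. {\<sigma>. i = Suc (bstring_encode \<sigma>) \<and> p (bstring_encode \<sigma>) = 0}"
  have "(\<lambda>(\<sigma>, d). (\<sigma>, int d)) ` s \<in> pm_dual m" if s: "finite s" "s \<subseteq> ?C" for s
  proof (rule pm_dualI_summable_cover[OF m, of _ ?D])
    show "finite ((\<lambda>(\<sigma>, d). (\<sigma>, int d)) ` s)" using s by simp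
    show "\<exists>i. int (length \<sigma>) - d < int i \<and> \<sigma> \<in> ?D i"
      if "(\<sigma>, d) \<in> (\<lambda>(\<sigma>, d). (\<sigma>, int d)) ` s" for \<sigma> d
      using that s(2) length_le_bstring_encode[of \<sigma>]
      by (intro exI[of _ "Suc (bstring_encode \<sigma>)"]) auto
    show "m F \<le> 1 / 2 ^ i" if F: "finite F" "F \<subseteq> ?D i" for i F
    proof (cases "F = {}")
      case True
      then show ?thesis by (simp add: pre_measureD(2)[OF m])
    next
      case False
      then obtain \<sigma> where \<sigma>: "\<sigma> \<in> F" by blast
      have "\<tau> = \<sigma>" if "\<tau> \<in> F" for \<tau>
        using F(2) \<sigma> that by (intro injD[OF inj_bstring_encode]) auto
      then have "F = {\<sigma>}" using \<sigma> by blast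
      then show ?thesis using p_small[of \<sigma>] F(2) by simp
    qed
  qed
  moreover have "re_pairs ?C"
  proof -
    let ?g = "\<lambda>v. prod_encode (v, 0)"
    have "re_set (?g ` {v \<in> UNIV. p v = 0})"
      unfolding p_def
      by (intro re_set_filter_image re_set_UNIV computable_prod_encode computable_diff computable_nth
          computable_const computable_add computable_power2
          computable_comp2[OF computable_recursive[OF f]]) auto
    also have "?g ` {v \<in> UNIV. p v = 0} = (\<lambda>(\<sigma>, d). prod_encode (bstring_encode \<sigma>, d)) ` ?C"
    proof -
      have "{v. p v = 0} = bstring_encode ` {\<sigma>. p (bstring_encode \<sigma>) = 0}"
        using surj_bstring_encode by (auto simp: image_iff)
      moreover have "?C = (\<lambda>\<sigma>. (\<sigma>, 0)) ` {\<sigma>. p (bstring_encode \<sigma>) = 0}" by blast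
      ultimately show ?thesis by (simp add: image_image)
    qed
    finally show ?thesis unfolding re_pairs_def .
  qed
  ultimately obtain c where "\<forall>(\<sigma>, d)\<in>?C. K \<sigma> < d + c"
    using K unfolding optimal_complexity_def by blast
  then show thesis using p_null by (intro that[of c]) fastforce
qed

lemma complex_imp_pm_random:
  assumes m: "pre_measure m" and K: "optimal_complexity (pm_dual m) K"
    and recur: "null_prefixes_recur m X" and X: "\<And>n. n \<le> K (X \<restriction> n) + b"
  shows "pm_random m X"
  unfolding pm_random_def
proof (intro allI impI notI)
  fix A assume A: "pm_test m A" and "X \<in> (\<Inter>i. cylinder (A i))"
  then have cover: "\<exists>n. X \<restriction> n \<in> A i" for i unfolding cylinder_def by blast
  obtain c where c: "\<And>i \<sigma>. \<sigma> \<in> A i \<Longrightarrow> K \<sigma> < (length \<sigma> + 1 - i) + c"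
    using test_complexity_bound[OF m K A] by blast
  \<comment> \<open>For \<open>i > b + c\<close>, a positive \<open>n + 1 - i\<close> would give
    \<open>n < n\<close>. So it is truncated to \<open>0\<close>, and
    \<open>n \<le> K (X \<restriction> n) + b < b + c\<close>.\<close>
  have "\<exists>n\<in>{..<b + c}. X \<restriction> n \<in> A i" if "i \<in> {b + c + 1..}" for i
  proof -
    obtain n where n: "X \<restriction> n \<in> A i" using cover by blast
    have "K (X \<restriction> n) < (n + 1 - i) + c" using c[OF n] by (simp add: initial_segment_def)
    then have "n < b + c" using X[of n] that by simp
    then show ?thesis using n by blast
  qed
  \<comment> \<open>Infinitely many levels share finitely many lengths, so one prefix
    recurs.\<close>
  then obtain n where n: "infinite {i \<in> {b + c + 1..}. X \<restriction> n \<in> A i}"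
    using pigeonhole_infinite_rel[of "{b + c + 1..}" "{..<b + c}" "\<lambda>i n. X \<restriction> n \<in> A i"]
      infinite_Ici by blast
  have "m {X \<restriction> n} = 0"
  proof (rule ccontr)
    assume "m {X \<restriction> n} \<noteq> 0"
    then have "0 < m {X \<restriction> n}" using pre_measureD(1)[OF m, of "{X \<restriction> n}"] by simp
    then obtain j where j: "(1 / 2) ^ j < m {X \<restriction> n}"
      using real_arch_pow_inv[of _ "1 / 2"] by auto
    obtain i where i: "j < i" "X \<restriction> n \<in> A i"
      using n unfolding infinite_nat_iff_unbounded by blast
    have "m {X \<restriction> n} \<le> 1 / 2 ^ i"
      using A i(2) unfolding pm_test_def pm_extend_le_iff by blast
    also have "\<dots> \<le> (1 / 2) ^ j" using i(1) by (simp add: power_one_over field_simps)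
    finally show False using j by simp
  qed
  moreover have next_null: "\<exists>k>l. m {X \<restriction> k} = 0" if "m {X \<restriction> l} = 0" for l
    using recur that unfolding null_prefixes_recur_def by simp
  \<comment> \<open>Recurrence turns a single null prefix into null prefixes beyond any
    length.\<close>
  ultimately have null: "\<exists>k>j. m {X \<restriction> k} = 0" for j
  proof (induction j)
    case 0
    then show ?case using next_null[of n] by (metis gr_zeroI not_less_zero)
  next
    case (Suc j)
    then obtain k where "k > j" "m {X \<restriction> k} = 0" by auto
    moreover obtain l where "l > k" "m {X \<restriction> l} = 0" using next_null[OF calculation(2)] by auto
    ultimately show ?case by (intro exI[of _ l]) simp
  qed
  obtain c' where c': "\<And>\<sigma>. m {\<sigma>} = 0 \<Longrightarrow> K \<sigma> < c'" using null_complexity_bound[OF m K] by blast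
  \<comment> \<open>Complexity below \<open>c'\<close> at length \<open>k\<close> contradicts
    \<open>k \<le> K (X \<restriction> k) + b\<close>.\<close>
  obtain k where "k > b + c'" "m {X \<restriction> k} = 0" using null by blast
  then show False using c'[of "X \<restriction> k"] X[of k] by simp
qed

theorem mainTheorem1:
  fixes m :: "bstring set \<Rightarrow> real"
    and R :: "(bstring \<times> int) set set"
    and X :: "nat \<Rightarrow> bool"
  assumes "pre_measure m"
    and "dual_rule m R"
    and "null_prefixes_recur m X"
  shows "pm_random m X \<longleftrightarrow> rule_complex R X"
proof -
  obtain K where K: "optimal_complexity (pm_dual m) K"
    and R: "rule_complex R X \<longleftrightarrow> (\<exists>c::nat. \<forall>n. n \<le> K (X \<restriction> n) + c)"
    using rule_complex_iff_dual[OF assms(2)] by metis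
  show ?thesis
    using pm_random_imp_complex[OF assms(1) K] complex_imp_pm_random[OF assms(1) K assms(3)] R
    by blast
qed

end
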